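(* Let $K$ be an algebraically closed field of characteristic $5$. Let $A=\mathcal O_2(2,1)$ be the divided powers algebra over $K$ in two variables $x,y$, with basis $\{x^{(i)}y^{(j)} : 0\le i<25,\ 0\le j<5\}$, and let $\partial_x,\partial_y$ be its derivations lowering the powers of $x$ and $y$ respectively. Let $\mathcal P$ be the Poisson Lie algebra on the vector space $A$ with bracket $$[a,b]=\partial_x(a)\partial_y(b)-\partial_y(a)\partial_x(b),$$ and let $\varphi,\psi: A\times A\to A$ be the bilinear maps $$\varphi(a,b)=\partial_x^2(a)\,\partial_x^3(b)-\partial_x^3(a)\,\partial_x^2(b),$$ $$\psi(a,b)=(\mathrm{id}-x\partial_x)(a)\,\partial_x^5(b)-\partial_x^5(a)\,(\mathrm{id}-x\partial_x)(b).$$ Let $\mathcal D$ be the deformation of $\mathcal P$ defined by the cocycle $\varphi+2\psi$, that is, the vector space $A$ with the bracket $$\{a,b\}=[a,b]+\varphi(a,b)+2\psi(a,b),\qquad a,b\in A.$$ Then $\mathcal D$ is isomorphic, as a Lie algebra over $K$, to the $125$-dimensional Melikyan algebra $\mathcal M(1,1)$ over $K$.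
   Context: **Divided powers algebras.** Let $K$ be a field of characteristic $p>0$ (here $p=5$). For positive integers $m_1,\dots,m_n$, the divided powers algebra $\mathcal O_n(m_1,\dots,m_n)$ is the commutative associative $K$-algebra with basis $\{x_1^{(i_1)}\cdots x_n^{(i_n)} : 0\le i_k<p^{m_k},\ k=1,\dots,n\}$ and multiplication $$x_1^{(i_1)}\cdots x_n^{(i_n)}\cdot x_1^{(j_1)}\cdots x_n^{(j_n)}=\binom{i_1+j_1}{i_1}\cdots\binom{i_n+j_n}{i_n}\,x_1^{(i_1+j_1)}\cdots x_n^{(i_n+j_n)},$$ with the conventions that $x_k^{(0)}=1$ is the unit and $x_k^{(i)}=0$ if $i<0$ or $i\ge p^{m_k}$. It has pairwise commuting derivations $$\partial_{x_k}: x_1^{(i_1)}\cdots x_k^{(i_k)}\cdots x_n^{(i_n)}\mapsto x_1^{(i_1)}\cdots x_k^{(i_k-1)}\cdots x_n^{(i_n)}.$$ For $\mathcal O_2(2,1)$ the variables are denoted $x,y$ instead of $x_1,x_2$. The symbol $x$ in $x\partial_x$ denotes the element $x^{(1)}$, acting by multiplication. Powers such as $\partial_x^5$ are iterated compositions, $\mathrm{id}$ is the identity map, and products of elements in the formulas for the brackets and for $\varphi,\psi$ are taken in the associative algebra $\mathcal O_2(2,1)$. **Melikyan algebra $\mathcal M(1,1)$ (standard definition, characteristic $5$).** Let $\mathcal O=\mathcal O_2(1,1)$ over $K$, with derivations $\partial_1=\partial_{x_1}$, $\partial_2=\partial_{x_2}$. Let $W=\mathcal W_2(1,1)=\mathcal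 O\partial_1\oplus\mathcal O\partial_2$ be the Lie algebra of derivations of $\mathcal O$, and let $\widetilde W=\{\widetilde E: E\in W\}$ be a copy of the vector space $W$ (so $E\mapsto\widetilde E$ is a linear isomorphism; write $f\widetilde\partial_i=\widetilde{f\partial_i}$). For $D=f_1\partial_1+f_2\partial_2$ put $\operatorname{div}(D)=\partial_1(f_1)+\partial_2(f_2)$. For $f\in\mathcal O$ put $D_f=\partial_1(f)\partial_2-\partial_2(f)\partial_1$. Then $\mathcal M(1,1)=\mathcal O\oplus W\oplus\widetilde W$ as a vector space (of dimension $25+50+50=125$), with the anticommutative bracket which on $W$ is the usual commutator of derivations, and otherwise is given, for $D,E\in W$ and $f,g,f_i,g_i\in\mathcal O$, by $$[D,\widetilde E]=\widetilde{[D,E]}+2\operatorname{div}(D)\widetilde E,\qquad [D,f]=D(f)-2\operatorname{div}(D)f,\qquad [f,\widetilde E]=fE,$$ $$[f,g]=2\bigl(f\widetilde{D_g}-g\widetilde{D_f}\bigr),\qquad [f_1\widetilde\partial_1+f_2\widetilde\partial_2,\ g_1\widetilde\partial_1+g_2\widetilde\partial_2]=f_1g_2-f_2g_1,$$ where $h\widetilde E$ means $\widetilde{hE}$ for $h\in\mathcal O$, $E\in W$. *)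

theory Defs
  imports
    "HOL-Computational_Algebra.Polynomial"
    "HOL-Library.Function_Algebras"
    "HOL-Library.Product_Plus"
begin

section \<open>Lie algebras on subspaces\<close>

locale lie_algebra = vector_space scale
  for scale :: "'k::field \<Rightarrow> 'v::ab_group_add \<Rightarrow> 'v" (infixr "*s" 75) +
  fixes L :: "'v set" and br :: "'v \<Rightarrow> 'v \<Rightarrow> 'v"
  assumes subspace_carrier: "subspace L"
    and br_closed: "\<lbrakk>a \<in> L; b \<in> L\<rbrakk> \<Longrightarrow> br a b \<in> L"
    and br_add_left: "\<lbrakk>a \<in> L; b \<in> L; c \<in> L\<rbrakk> \<Longrightarrow> br (a + b) c = br a c + br b c"
    and br_add_right: "\<lbrakk>a \<in> L; b \<in> L; c \<in> L\<rbrakk> \<Longrightarrow> br a (b + c) = br a b + br a c"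
    and br_scale_left: "\<lbrakk>a \<in> L; b \<in> L\<rbrakk> \<Longrightarrow> br (t *s a) b = t *s br a b"
    and br_scale_right: "\<lbrakk>a \<in> L; b \<in> L\<rbrakk> \<Longrightarrow> br a (t *s b) = t *s br a b"
    and br_alternating: "a \<in> L \<Longrightarrow> br a a = 0"
    and br_jacobi: "\<lbrakk>a \<in> L; b \<in> L; c \<in> L\<rbrakk> \<Longrightarrow>
      br (br a b) c + br (br b c) a + br (br c a) b = 0"

definition lie_isomorphic ::
    "('k::field \<Rightarrow> 'v::ab_group_add \<Rightarrow> 'v) \<Rightarrow> 'v set \<Rightarrow> ('v \<Rightarrow> 'v \<Rightarrow> 'v) \<Rightarrow>
     ('k \<Rightarrow> 'w::ab_group_add \<Rightarrow> 'w) \<Rightarrow> 'w set \<Rightarrow> ('w \<Rightarrow> 'w \<Rightarrow> 'w) \<Rightarrow> bool" where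
  "lie_isomorphic s1 L1 br1 s2 L2 br2 \<longleftrightarrow>
     lie_algebra s1 L1 br1 \<and> lie_algebra s2 L2 br2 \<and>
     (\<exists>h. bij_betw h L1 L2 \<and>
        (\<forall>a\<in>L1. \<forall>b\<in>L1. h (a + b) = h a + h b) \<and>
        (\<forall>t. \<forall>a\<in>L1. h (s1 t a) = s2 t (h a)) \<and>
        (\<forall>a\<in>L1. \<forall>b\<in>L1. h (br1 a b) = br2 (h a) (h b)))"


section \<open>Divided powers algebras in two variables\<close>

text \<open>
  An element of the divided powers algebra is given by its coefficients: \<open>f i j\<close> is the
  coefficient of \<open>x\<^sup>(\<^sup>i\<^sup>) y\<^sup>(\<^sup>j\<^sup>)\<close>. The characteristic is that of the coefficient field.
  Addition is the pointwise one of Function_Algebras; the pointwise product provided there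
  is \<^emph>\<open>not\<close> the product of the algebra.
\<close>

type_synonym 'k dp = "nat \<Rightarrow> nat \<Rightarrow> 'k"

definition dp_carrier :: "nat \<Rightarrow> nat \<Rightarrow> 'k::field dp set" where
  "dp_carrier m1 m2 = {f. \<forall>i j. f i j \<noteq> 0 \<longrightarrow> i < CHAR('k) ^ m1 \<and> j < CHAR('k) ^ m2}"

definition dp_scale :: "'k::field \<Rightarrow> 'k dp \<Rightarrow> 'k dp" where
  "dp_scale t f = (\<lambda>i j. t * f i j)"

definition dp_monom :: "nat \<Rightarrow> nat \<Rightarrow> 'k::field dp" where
  "dp_monom i j = (\<lambda>a b. if a = i \<and> b = j then 1 else 0)"

definition dp_mult :: "nat \<Rightarrow> nat \<Rightarrow> 'k::field dp \<Rightarrow> 'k dp \<Rightarrow> 'k dp" where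
  "dp_mult m1 m2 f g = (\<lambda>i j.
     if i < CHAR('k) ^ m1 \<and> j < CHAR('k) ^ m2
     then \<Sum>a\<le>i. \<Sum>b\<le>j. of_nat (i choose a) * of_nat (j choose b) * f a b * g (i - a) (j - b)
     else 0)"

text \<open>The derivations sending \<open>x\<^sup>(\<^sup>i\<^sup>)\<close> to \<open>x\<^sup>(\<^sup>i\<^sup>-\<^sup>1\<^sup>)\<close> and \<open>y\<^sup>(\<^sup>j\<^sup>)\<close> to \<open>y\<^sup>(\<^sup>j\<^sup>-\<^sup>1\<^sup>)\<close>, respectively.\<close>

definition dp_d1 :: "'k::field dp \<Rightarrow> 'k dp" where
  "dp_d1 f = (\<lambda>i j. f (Suc i) j)"

definition dp_d2 :: "'k::field dp \<Rightarrow> 'k dp" where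
  "dp_d2 f = (\<lambda>i j. f i (Suc j))"

lemma dp_mult_monom:
  "dp_mult m1 m2 (dp_monom i1 i2) (dp_monom j1 j2 :: 'k::field dp) =
     (if i1 + j1 < CHAR('k) ^ m1 \<and> i2 + j2 < CHAR('k) ^ m2
      then dp_scale (of_nat (i1 + j1 choose i1) * of_nat (i2 + j2 choose i2))
             (dp_monom (i1 + j1) (i2 + j2))
      else 0)"
proof -
  have eq: "(\<Sum>a\<le>i. \<Sum>b\<le>j. of_nat (i choose a) * of_nat (j choose b) *
               dp_monom i1 i2 a b * dp_monom j1 j2 (i - a) (j - b)) =
        (if i = i1 + j1 \<and> j = i2 + j2
         then of_nat (i choose i1) * of_nat (j choose i2) else (0 :: 'k))" for i j
  proof -
    have "(\<Sum>a\<le>i. \<Sum>b\<le>j. of_nat (i choose a) * of_nat (j choose b) *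
               dp_monom i1 i2 a b * dp_monom j1 j2 (i - a) (j - b)) =
          (\<Sum>a\<le>i. \<Sum>b\<le>j. if b = i2 then (if a = i1 then
              of_nat (i choose i1) * of_nat (j choose i2) *
              (dp_monom j1 j2 (i - i1) (j - i2) :: 'k) else 0) else 0)"
      by (intro sum.cong refl) (simp add: dp_monom_def[of i1 i2])
    also have "\<dots> = (if i1 \<le> i \<and> i2 \<le> j then
              of_nat (i choose i1) * of_nat (j choose i2) *
              (dp_monom j1 j2 (i - i1) (j - i2) :: 'k) else 0)"
      by (cases "i2 \<le> j") simp_all
    also have "\<dots> = (if i = i1 + j1 \<and> j = i2 + j2
         then of_nat (i choose i1) * of_nat (j choose i2) else 0)"
      by (auto simp: dp_monom_def)
    finally show ?thesis .
  qed
  show ?thesis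
    unfolding dp_mult_def eq
    by (auto simp: fun_eq_iff dp_scale_def dp_monom_def)
qed

lemma dp_d1_monom: "dp_d1 (dp_monom i j) = (if i = 0 then 0 else dp_monom (i - 1) j)"
  by (auto simp: dp_d1_def dp_monom_def fun_eq_iff)

lemma dp_d2_monom: "dp_d2 (dp_monom i j) = (if j = 0 then 0 else dp_monom i (j - 1))"
  by (auto simp: dp_d2_def dp_monom_def fun_eq_iff)


section \<open>The deformed Poisson algebra on \<open>\<O>\<^sub>2(2,1)\<close>\<close>

abbreviation A_mult :: "'k::field dp \<Rightarrow> 'k dp \<Rightarrow> 'k dp" (infixl "\<star>" 70) where
  "f \<star> g \<equiv> dp_mult 2 1 f g"

definition poisson_bracket :: "'k::field dp \<Rightarrow> 'k dp \<Rightarrow> 'k dp" where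
  "poisson_bracket a b = dp_d1 a \<star> dp_d2 b - dp_d2 a \<star> dp_d1 b"

definition phi :: "'k::field dp \<Rightarrow> 'k dp \<Rightarrow> 'k dp" where
  "phi a b = (dp_d1 ^^ 2) a \<star> (dp_d1 ^^ 3) b - (dp_d1 ^^ 3) a \<star> (dp_d1 ^^ 2) b"

definition id_minus_xdx :: "'k::field dp \<Rightarrow> 'k dp" where
  "id_minus_xdx a = a - dp_monom 1 0 \<star> dp_d1 a"

definition psi :: "'k::field dp \<Rightarrow> 'k dp \<Rightarrow> 'k dp" where
  "psi a b = id_minus_xdx a \<star> (dp_d1 ^^ 5) b - (dp_d1 ^^ 5) a \<star> id_minus_xdx b"

definition deformed_bracket :: "'k::field dp \<Rightarrow> 'k dp \<Rightarrow> 'k dp" where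
  "deformed_bracket a b = poisson_bracket a b + phi a b + dp_scale 2 (psi a b)"


section \<open>The Melikyan algebra \<open>\<M>(1,1)\<close>\<close>

abbreviation O_mult :: "'k::field dp \<Rightarrow> 'k dp \<Rightarrow> 'k dp" (infixl "\<cdot>" 70) where
  "f \<cdot> g \<equiv> dp_mult 1 1 f g"

text \<open>
  The pair \<open>(f\<^sub>1, f\<^sub>2)\<close> stands for the derivation \<open>f\<^sub>1\<partial>\<^sub>1 + f\<^sub>2\<partial>\<^sub>2\<close> of \<open>\<O>\<^sub>2(1,1)\<close>.
\<close>

type_synonym 'k vf = "'k dp \<times> 'k dp"

definition vf_apply :: "'k::field vf \<Rightarrow> 'k dp \<Rightarrow> 'k dp" where
  "vf_apply D h = fst D \<cdot> dp_d1 h + snd D \<cdot> dp_d2 h"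

definition vf_mult :: "'k::field dp \<Rightarrow> 'k vf \<Rightarrow> 'k vf" where
  "vf_mult f D = (f \<cdot> fst D, f \<cdot> snd D)"

definition vf_scale :: "'k::field \<Rightarrow> 'k vf \<Rightarrow> 'k vf" where
  "vf_scale t D = (dp_scale t (fst D), dp_scale t (snd D))"

text \<open>
  The commutator of derivations, in coordinates; see \<open>vf_apply_bracket\<close> and
  \<open>vf_apply_inject\<close> below.
\<close>

definition vf_bracket :: "'k::field vf \<Rightarrow> 'k vf \<Rightarrow> 'k vf" where
  "vf_bracket D E = (vf_apply D (fst E) - vf_apply E (fst D),
                     vf_apply D (snd E) - vf_apply E (snd D))"

definition vf_div :: "'k::field vf \<Rightarrow> 'k dp" where
  "vf_div D = dp_d1 (fst D) + dp_d2 (snd D)"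

text \<open>\<open>D\<^sub>f = \<partial>\<^sub>1(f)\<partial>\<^sub>2 - \<partial>\<^sub>2(f)\<partial>\<^sub>1\<close>\<close>

definition vf_ham :: "'k::field dp \<Rightarrow> 'k vf" where
  "vf_ham f = (- dp_d2 f, dp_d1 f)"

text \<open>\<open>(f, D, E)\<close> stands for \<open>f + D + \<close>(the copy of \<open>E\<close> in the second summand \<open>W\<close>).\<close>

type_synonym 'k mel = "'k dp \<times> 'k vf \<times> 'k vf"

definition mel_carrier :: "'k::field mel set" where
  "mel_carrier = dp_carrier 1 1 \<times> (dp_carrier 1 1 \<times> dp_carrier 1 1) \<times>
                 (dp_carrier 1 1 \<times> dp_carrier 1 1)"

definition mel_scale :: "'k::field \<Rightarrow> 'k mel \<Rightarrow> 'k mel" where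
  "mel_scale t = (\<lambda>(f, D, E). (dp_scale t f, vf_scale t D, vf_scale t E))"

text \<open>\<open>[D, f]\<close> for \<open>D\<close> in \<open>W\<close>, and the coordinates of \<open>[D, E\<^sup>~]\<close> for \<open>E\<^sup>~\<close> in the copy of \<open>W\<close>\<close>

definition mel_act_fun :: "'k::field vf \<Rightarrow> 'k dp \<Rightarrow> 'k dp" where
  "mel_act_fun D f = vf_apply D f - dp_scale 2 (vf_div D \<cdot> f)"

definition mel_act_tilde :: "'k::field vf \<Rightarrow> 'k vf \<Rightarrow> 'k vf" where
  "mel_act_tilde D E = vf_bracket D E + vf_scale 2 (vf_mult (vf_div D) E)"

text \<open>The bilinear anticommutative extension of the brackets between the three summands\<close>

definition mel_bracket :: "'k::field mel \<Rightarrow> 'k mel \<Rightarrow> 'k mel" where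
  "mel_bracket = (\<lambda>(f, D, E) (f', D', E').
     (mel_act_fun D f' - mel_act_fun D' f + (fst E \<cdot> snd E' - snd E \<cdot> fst E'),
      vf_bracket D D' + vf_mult f E' - vf_mult f' E,
      mel_act_tilde D E' - mel_act_tilde D' E
        + vf_scale 2 (vf_mult f (vf_ham f') - vf_mult f' (vf_ham f))))"

subsection \<open>The bracket on \<open>W\<close> is the commutator of derivations\<close>

lemma dp_mult_add_left: "dp_mult m1 m2 (f + g) h = dp_mult m1 m2 f h + dp_mult m1 m2 g h"
  by (auto simp: dp_mult_def fun_eq_iff algebra_simps sum.distrib)

lemma dp_mult_add_right: "dp_mult m1 m2 h (f + g) = dp_mult m1 m2 h f + dp_mult m1 m2 h g"
  by (auto simp: dp_mult_def fun_eq_iff algebra_simps sum.distrib)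

lemma dp_mult_diff_left: "dp_mult m1 m2 (f - g) h = dp_mult m1 m2 f h - dp_mult m1 m2 g h"
  by (auto simp: dp_mult_def fun_eq_iff algebra_simps sum_subtractf)

lemma sum_atMost_reverse:
  fixes F :: "nat \<Rightarrow> 'a::comm_monoid_add"
  shows "(\<Sum>a\<le>n. F a) = (\<Sum>a\<le>n. F (n - a))"
  by (rule sum.reindex_bij_witness[of _ "\<lambda>a. n - a" "\<lambda>a. n - a"]) auto

lemma dp_mult_commute: "dp_mult m1 m2 f g = dp_mult m1 m2 g f"
proof -
  have "(\<Sum>a\<le>i. \<Sum>b\<le>j. of_nat (i choose a) * of_nat (j choose b) * f a b * g (i - a) (j - b)) =
        (\<Sum>a\<le>i. \<Sum>b\<le>j. of_nat (i choose a) * of_nat (j choose b) * g a b * f (i - a) (j - b))"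
    for i j
    by (subst sum_atMost_reverse, rule sum.cong[OF refl],
        subst sum_atMost_reverse, rule sum.cong[OF refl])
       (simp add: mult_ac flip: binomial_symmetric)
  then show ?thesis
    unfolding dp_mult_def by presburger
qed

lemma binomial_convolution_assoc:
  fixes P :: "nat \<Rightarrow> nat \<Rightarrow> nat \<Rightarrow> 'k::comm_semiring_1"
  shows "(\<Sum>i\<le>n. \<Sum>a\<le>i. of_nat (n choose i) * of_nat (i choose a) * P a (i - a) (n - i)) =
         (\<Sum>a\<le>n. \<Sum>b\<le>n - a. of_nat (n choose a) * of_nat (n - a choose b) * P a b (n - a - b))"
  unfolding sum.Sigma[OF finite_atMost ballI[OF finite_atMost]]
  apply (rule sum.reindex_bij_witness[of _ "\<lambda>(a, b). (a + b, a)" "\<lambda>(i, a). (a, i - a)"])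
      apply (auto simp: choose_mult simp flip: of_nat_mult)
  done

lemma dp_mult_assoc:
  "dp_mult m1 m2 (dp_mult m1 m2 f g) h = dp_mult m1 m2 f (dp_mult m1 m2 g h)"
proof (intro ext)
  fix i j
  show "dp_mult m1 m2 (dp_mult m1 m2 f g) h i j = dp_mult m1 m2 f (dp_mult m1 m2 g h) i j"
  proof (cases "i < CHAR('a) ^ m1 \<and> j < CHAR('a) ^ m2")
    case True
    have "dp_mult m1 m2 (dp_mult m1 m2 f g) h i j =
       (\<Sum>a\<le>i. \<Sum>b\<le>j. of_nat (i choose a) * of_nat (j choose b) *
         (\<Sum>c\<le>a. \<Sum>d\<le>b. of_nat (a choose c) * of_nat (b choose d) *
             f c d * g (a - c) (b - d)) * h (i - a) (j - b))"
      using True unfolding dp_mult_def[of m1 m2 "dp_mult m1 m2 f g"]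
      by (auto simp: dp_mult_def intro!: sum.cong)
    also have "\<dots> = (\<Sum>a\<le>i. \<Sum>b\<le>j. \<Sum>c\<le>a. \<Sum>d\<le>b. of_nat (i choose a) * of_nat (a choose c) *
          (of_nat (j choose b) * of_nat (b choose d) *
             (f c d * g (a - c) (b - d) * h (i - a) (j - b))))"
      by (simp add: sum_distrib_left sum_distrib_right mult_ac)
    also have "\<dots> = (\<Sum>a\<le>i. \<Sum>c\<le>a. of_nat (i choose a) * of_nat (a choose c) *
         (\<Sum>b\<le>j. \<Sum>d\<le>b. of_nat (j choose b) * of_nat (b choose d) *
             (f c d * g (a - c) (b - d) * h (i - a) (j - b))))"
      unfolding sum_distrib_left by (rule sum.cong[OF refl], rule sum.swap)
    also have "\<dots> = (\<Sum>c\<le>i. \<Sum>e\<le>i - c. of_nat (i choose c) * of_nat (i - c choose e) *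
         (\<Sum>d\<le>j. \<Sum>b\<le>j - d. of_nat (j choose d) * of_nat (j - d choose b) *
             (f c d * g e b * h (i - c - e) (j - d - b))))"
      unfolding
        binomial_convolution_assoc[of j "\<lambda>d b r. f _ d * g (_ - _) b * h (i - _) r"]
      by (rule binomial_convolution_assoc[of i "\<lambda>c e r. \<Sum>d\<le>j. \<Sum>b\<le>j - d.
            of_nat (j choose d) * of_nat (j - d choose b) *
             (f c d * g e b * h r (j - d - b))"])
    also have "\<dots> = (\<Sum>c\<le>i. \<Sum>d\<le>j. \<Sum>e\<le>i - c. \<Sum>b\<le>j - d.
         of_nat (i choose c) * of_nat (i - c choose e) *
         (of_nat (j choose d) * of_nat (j - d choose b) *
             (f c d * g e b * h (i - c - e) (j - d - b))))"
      unfolding sum_distrib_left by (rule sum.cong[OF refl], rule sum.swap)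
    also have "\<dots> = (\<Sum>c\<le>i. \<Sum>d\<le>j. of_nat (i choose c) * of_nat (j choose d) * f c d *
         (\<Sum>e\<le>i - c. \<Sum>b\<le>j - d. of_nat (i - c choose e) * of_nat (j - d choose b) *
             g e b * h (i - c - e) (j - d - b)))"
      by (simp add: sum_distrib_left sum_distrib_right mult_ac)
    also have "\<dots> = dp_mult m1 m2 f (dp_mult m1 m2 g h) i j"
      using True unfolding dp_mult_def[of m1 m2 f "dp_mult m1 m2 g h"]
      by (auto simp: dp_mult_def intro!: sum.cong)
    finally show ?thesis .
  qed (auto simp: dp_mult_def)
qed

lemma dp_mult_left_commute:
  "dp_mult m1 m2 f (dp_mult m1 m2 g h) = dp_mult m1 m2 g (dp_mult m1 m2 f h)"
  by (metis dp_mult_assoc dp_mult_commute)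

lemma of_nat_choose_CHAR_power_eq_0:
  assumes "prime CHAR('k::field)" "0 < k" "k < CHAR('k) ^ m"
  shows "of_nat (CHAR('k) ^ m choose k) = (0 :: 'k)"
proof -
  let ?p = "CHAR('k)"
  have eq: "k * (?p ^ m choose k) = ?p ^ m * (?p ^ m - 1 choose (k - 1))"
    using assms times_binomial_minus1_eq by auto
  have "?p dvd (?p ^ m choose k)"
  proof (rule ccontr)
    assume "\<not> ?p dvd (?p ^ m choose k)"
    then have "coprime (?p ^ m) (?p ^ m choose k)"
      using assms(1) by (simp add: prime_imp_coprime)
    moreover have "?p ^ m dvd k * (?p ^ m choose k)"
      unfolding eq by simp
    ultimately have "?p ^ m dvd k"
      by (simp add: coprime_dvd_mult_left_iff)
    then show False
      using assms by (auto dest: dvd_imp_le)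
  qed
  then show ?thesis
    using of_nat_eq_0_iff_char_dvd by blast
qed

lemma pascal_convolution:
  fixes P :: "nat \<Rightarrow> nat \<Rightarrow> 'k::comm_semiring_1"
  shows "(\<Sum>a\<le>Suc n. of_nat (Suc n choose a) * P a (Suc n - a)) =
         (\<Sum>a\<le>n. of_nat (n choose a) * (P (Suc a) (n - a) + P a (Suc (n - a))))"
proof -
  have "(\<Sum>a\<le>Suc n. of_nat (Suc n choose a) * P a (Suc n - a)) =
     P 0 (Suc n) + (\<Sum>a\<le>n. of_nat (n choose a) * P (Suc a) (n - a)) +
       (\<Sum>a\<le>n. of_nat (n choose Suc a) * P (Suc a) (n - a))"
    unfolding sum.atMost_Suc_shift by (simp add: distrib_right sum.distrib add_ac)
  also have "P 0 (Suc n) + (\<Sum>a\<le>n. of_nat (n choose a) * P (Suc a) (n - a)) +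
       (\<Sum>a\<le>n. of_nat (n choose Suc a) * P (Suc a) (n - a)) =
      (\<Sum>a\<le>n. of_nat (n choose a) * P (Suc a) (n - a)) +
      (\<Sum>a\<le>Suc n. of_nat (n choose a) * P a (Suc n - a))"
    unfolding sum.atMost_Suc_shift by (simp add: add_ac)
  also have "\<dots> = (\<Sum>a\<le>n. of_nat (n choose a) * (P (Suc a) (n - a) + P a (Suc (n - a))))"
    by (simp add: distrib_left sum.distrib Suc_diff_le binomial_eq_0)
  finally show ?thesis .
qed

lemma dp_d1_mult:
  fixes f g :: "'k::field dp"
  assumes p: "prime CHAR('k)" and f: "f \<in> dp_carrier m1 m2" and g: "g \<in> dp_carrier m1 m2"
  shows "dp_d1 (dp_mult m1 m2 f g) = dp_mult m1 m2 (dp_d1 f) g + dp_mult m1 m2 f (dp_d1 g)"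
proof (intro ext)
  fix i j
  let ?N = "CHAR('k) ^ m1"
  define P where "P a c = (\<Sum>b\<le>j. of_nat (j choose b) * f a b * g c (j - b))" for a c
  have P: "(\<Sum>a\<le>i. of_nat (i choose a) * P a (i - a)) =
      (\<Sum>a\<le>i. \<Sum>b\<le>j. of_nat (i choose a) * of_nat (j choose b) * f a b * g (i - a) (j - b))" for i
    by (simp add: P_def sum_distrib_left mult_ac)
  consider "i < ?N" "j < CHAR('k) ^ m2" | "i \<ge> ?N \<or> j \<ge> CHAR('k) ^ m2" by linarith
  then show "dp_d1 (dp_mult m1 m2 f g) i j =
      (dp_mult m1 m2 (dp_d1 f) g + dp_mult m1 m2 f (dp_d1 g)) i j"
  proof cases
    case 1
    have "(dp_mult m1 m2 (dp_d1 f) g + dp_mult m1 m2 f (dp_d1 g)) i j =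
        (\<Sum>a\<le>i. of_nat (i choose a) * (P (Suc a) (i - a) + P a (Suc (i - a))))"
      using 1 by (simp add: dp_mult_def dp_d1_def P_def sum.distrib distrib_left
          sum_distrib_left mult_ac)
    also have "\<dots> = (\<Sum>a\<le>Suc i. of_nat (Suc i choose a) * P a (Suc i - a))"
      by (rule pascal_convolution[symmetric])
    also have "\<dots> = dp_d1 (dp_mult m1 m2 f g) i j"
    proof (cases "Suc i < ?N")
      case True
      then show ?thesis
        using 1 unfolding P by (simp add: dp_mult_def dp_d1_def)
    next
      case False
      with 1 have N: "Suc i = ?N" by simp
      have "of_nat (Suc i choose a) * P a (Suc i - a) = 0" if "a \<le> Suc i" for a
      proof -
        consider "a = 0" | "a = Suc i" | "0 < a" "a < Suc i" using \<open>a \<le> Suc i\<close> by linarith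
        then show ?thesis
        proof cases
          case 1
          have "g (Suc i) b = 0" for b using g N by (auto simp: dp_carrier_def)
          with 1 show ?thesis by (simp add: P_def)
        next
          case 2
          have "f (Suc i) b = 0" for b using f N by (auto simp: dp_carrier_def)
          with 2 show ?thesis by (simp add: P_def)
        next
          case 3
          then show ?thesis
            using of_nat_choose_CHAR_power_eq_0[OF p, of a m1] by (simp add: N)
        qed
      qed
      then have "(\<Sum>a\<le>Suc i. of_nat (Suc i choose a) * P a (Suc i - a)) = 0"
        by (intro sum.neutral) simp
      then show ?thesis
        using N by (simp add: dp_mult_def dp_d1_def)
    qed
    finally show ?thesis by (rule sym)
  qed (auto simp: dp_mult_def dp_d1_def)
qed

lemma dp_mult_swap:
  "dp_mult m2 m1 (\<lambda>i j. f j i) (\<lambda>i j. g j i) = (\<lambda>i j. dp_mult m1 m2 f g j i)"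
proof (intro ext)
  fix i j
  have "(\<Sum>a\<le>i. \<Sum>b\<le>j. of_nat (i choose a) * of_nat (j choose b) * f b a * g (j - b) (i - a)) =
        (\<Sum>b\<le>j. \<Sum>a\<le>i. of_nat (j choose b) * of_nat (i choose a) * f b a * g (j - b) (i - a))"
    by (rule trans[OF sum.swap]) (simp only: mult.commute[of "of_nat (i choose _)"])
  then show "dp_mult m2 m1 (\<lambda>i j. f j i) (\<lambda>i j. g j i) i j = dp_mult m1 m2 f g j i"
    by (auto simp: dp_mult_def)
qed

lemma dp_d2_mult:
  fixes f g :: "'k::field dp"
  assumes "prime CHAR('k)" "f \<in> dp_carrier m1 m2" "g \<in> dp_carrier m1 m2"
  shows "dp_d2 (dp_mult m1 m2 f g) = dp_mult m1 m2 (dp_d2 f) g + dp_mult m1 m2 f (dp_d2 g)"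
proof (intro ext)
  fix i j
  have d2: "(\<lambda>i j. dp_d2 u j i) = dp_d1 (\<lambda>i j. u j i)" for u :: "'k dp"
    by (simp add: dp_d1_def dp_d2_def)
  have "dp_d2 (dp_mult m1 m2 f g) i j = dp_d1 (dp_mult m2 m1 (\<lambda>i j. f j i) (\<lambda>i j. g j i)) j i"
    by (subst dp_mult_swap) (simp add: dp_d1_def dp_d2_def)
  also have "\<dots> = dp_mult m2 m1 (\<lambda>i j. dp_d2 f j i) (\<lambda>i j. g j i) j i +
                   dp_mult m2 m1 (\<lambda>i j. f j i) (\<lambda>i j. dp_d2 g j i) j i"
    unfolding d2 using assms by (subst dp_d1_mult) (auto simp: dp_carrier_def)
  finally show "dp_d2 (dp_mult m1 m2 f g) i j =
      (dp_mult m1 m2 (dp_d2 f) g + dp_mult m1 m2 f (dp_d2 g)) i j"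
    by (simp add: dp_mult_swap[of m2 m1 "dp_d2 f" g] dp_mult_swap[of m2 m1 f "dp_d2 g"])
qed

lemma dp_d1_carrier: "f \<in> dp_carrier m1 m2 \<Longrightarrow> dp_d1 f \<in> dp_carrier m1 m2"
  unfolding dp_carrier_def dp_d1_def using Suc_lessD by blast

lemma dp_d2_carrier: "f \<in> dp_carrier m1 m2 \<Longrightarrow> dp_d2 f \<in> dp_carrier m1 m2"
  unfolding dp_carrier_def dp_d2_def using Suc_lessD by blast

lemma dp_d1_add: "dp_d1 (f + g) = dp_d1 f + dp_d1 g"
  and dp_d2_add: "dp_d2 (f + g) = dp_d2 f + dp_d2 g"
  and dp_d1_d2: "dp_d1 (dp_d2 f) = dp_d2 (dp_d1 f)"
  by (simp_all add: dp_d1_def dp_d2_def fun_eq_iff)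

lemma vf_apply_bracket:
  fixes D E :: "'k::field vf" and h :: "'k dp"
  assumes p: "prime CHAR('k)"
    and D: "D \<in> dp_carrier 1 1 \<times> dp_carrier 1 1"
    and E: "E \<in> dp_carrier 1 1 \<times> dp_carrier 1 1"
    and h: "h \<in> dp_carrier 1 1"
  shows "vf_apply (vf_bracket D E) h = vf_apply D (vf_apply E h) - vf_apply E (vf_apply D h)"
proof -
  obtain d1 d2 where Deq: "D = (d1, d2)" by fastforce
  obtain e1 e2 where Eeq: "E = (e1, e2)" by fastforce
  have mem: "d1 \<in> dp_carrier 1 1" "d2 \<in> dp_carrier 1 1" "e1 \<in> dp_carrier 1 1"
      "e2 \<in> dp_carrier 1 1" "dp_d1 h \<in> dp_carrier 1 1" "dp_d2 h \<in> dp_carrier 1 1"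
    using D E h Deq Eeq by (auto intro: dp_d1_carrier dp_d2_carrier)
  note leibniz = dp_d1_mult[OF p mem(1) mem(5)] dp_d1_mult[OF p mem(2) mem(6)]
    dp_d1_mult[OF p mem(3) mem(5)] dp_d1_mult[OF p mem(4) mem(6)]
    dp_d2_mult[OF p mem(1) mem(5)] dp_d2_mult[OF p mem(2) mem(6)]
    dp_d2_mult[OF p mem(3) mem(5)] dp_d2_mult[OF p mem(4) mem(6)]
  show ?thesis
    unfolding Deq Eeq vf_bracket_def vf_apply_def
    by (simp add: leibniz dp_d1_add dp_d2_add dp_d1_d2 dp_mult_add_left dp_mult_add_right
        dp_mult_diff_left dp_mult_assoc algebra_simps del: One_nat_def)
      (simp add: dp_mult_left_commute del: One_nat_def)
qed

lemma vf_apply_inject: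
  fixes D E :: "'k::field vf"
  assumes p: "prime CHAR('k)"
    and D: "D \<in> dp_carrier 1 1 \<times> dp_carrier 1 1"
    and E: "E \<in> dp_carrier 1 1 \<times> dp_carrier 1 1"
    and eq: "\<And>h. h \<in> dp_carrier 1 1 \<Longrightarrow> vf_apply D h = vf_apply E h"
  shows "D = E"
proof -
  have p1: "1 < CHAR('k)" using p by (rule prime_gt_1_nat)
  have one: "f \<cdot> dp_monom 0 0 = f" if "f \<in> dp_carrier 1 1" for f :: "'k dp"
  proof (intro ext)
    fix i j
    have "(\<Sum>a\<le>i. \<Sum>b\<le>j. of_nat (i choose a) * of_nat (j choose b) *
            f a b * dp_monom 0 0 (i - a) (j - b)) =
          (\<Sum>a\<le>i. \<Sum>b\<le>j. if b = j then (if a = i then f i j else 0) else 0)"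
      by (intro sum.cong refl) (auto simp: dp_monom_def)
    also have "\<dots> = f i j" by simp
    finally show "(f \<cdot> dp_monom 0 0) i j = f i j"
      using that by (auto simp: dp_mult_def dp_carrier_def)
  qed
  have zero: "f \<cdot> 0 = 0" for f :: "'k dp"
    by (auto simp: dp_mult_def fun_eq_iff)
  have "dp_monom 1 0 \<in> (dp_carrier 1 1 :: 'k dp set)" "dp_monom 0 1 \<in> (dp_carrier 1 1 :: 'k dp set)"
    using p1 by (auto simp: dp_carrier_def dp_monom_def split: if_splits)
  from this[THEN eq] D E show ?thesis
    by (auto simp: vf_apply_def dp_d1_monom dp_d2_monom one zero simp del: One_nat_def)
qed


end

theory Submission
  imports Defs
begin

text \<open>
  Reading \<open>x\<^sup>(\<^sup>5\<^sup>m\<^sup>+\<^sup>r\<^sup>)\<close> as \<open>X\<^sup>(\<^sup>m\<^sup>) x\<^sup>(\<^sup>r\<^sup>)\<close> with \<open>r < 5\<close> splits \<open>a \<in> \<O>\<^sub>2(2,1)\<close> into five components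
  \<open>a\<^sub>0, \<dots>, a\<^sub>4 \<in> \<O>\<^sub>2(1,1)\<close> in \<open>X, y\<close>, matching the five copies of \<open>\<O>\<^sub>2(1,1)\<close> that make up \<open>\<M>(1,1)\<close>:
  the isomorphism sends \<open>a\<close> to \<open>3a\<^sub>2 + (2a\<^sub>0 \<partial>\<^sub>1 + a\<^sub>1 \<partial>\<^sub>2) + (4a\<^sub>3 \<partial>\<^sub>1 + 2(a\<^sub>4 + \<partial>\<^sub>y a\<^sub>0) \<partial>\<^sub>2)\<^sup>~\<close>. The
  shape is dictated by the grading \<open>deg x\<^sup>(\<^sup>i\<^sup>) y\<^sup>(\<^sup>j\<^sup>) = i + 4j - 5\<close> of the deformed bracket, and the
  term \<open>\<partial>\<^sub>y a\<^sub>0\<close> is the only correction of the same degree. On components \<open>\<partial>\<^sub>x\<close> shifts the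
  index, with \<open>\<partial>\<^sub>X a\<^sub>0\<close> reappearing as component \<open>4\<close>, so compatibility with the brackets is an
  identity between differential polynomials in the components. The Jacobi identity is proved for
  the deformed bracket and transported to \<open>\<M>(1,1)\<close>.

  To compute in a genuine commutative ring, the divided powers algebras are embedded
  into the ring of Hurwitz series (divided power series without truncation), where \<open>\<partial>\<^sub>x\<close> and
  \<open>\<partial>\<^sub>y\<close> are derivations; the truncated products agree with the full one because binomial
  coefficients with a carry vanish in characteristic \<open>5\<close>.
\<close>

section \<open>Hurwitz series\<close>

text \<open>Coefficient \<open>n\<close> belongs to the divided power x^(n). Nesting the type gives
  two variables, outer index for \<open>x\<close> and inner for \<open>y\<close>. A separate type is
  used because functions already carry the pointwise product.\<close>

typedef 'a hurwitz = "UNIV :: (nat \<Rightarrow> 'a) set"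
  morphisms coeff_h Hurwitz by simp

lemma hurwitz_eqI: "(\<And>n. coeff_h f n = coeff_h g n) \<Longrightarrow> f = g"
  by (simp add: coeff_h_inject[symmetric] fun_eq_iff)

lemma coeff_Hurwitz [simp]: "coeff_h (Hurwitz f) = f"
  by (simp add: Hurwitz_inverse)

instantiation hurwitz :: (comm_ring_1) comm_ring_1
begin

definition "0 = Hurwitz (\<lambda>n. 0)"
definition "1 = Hurwitz (\<lambda>n. if n = 0 then 1 else 0)"
definition "f + g = Hurwitz (\<lambda>n. coeff_h f n + coeff_h g n)"
definition "f - g = Hurwitz (\<lambda>n. coeff_h f n - coeff_h g n)"
definition "- f = Hurwitz (\<lambda>n. - coeff_h f n)"
definition "f * g = Hurwitz (\<lambda>n. \<Sum>k\<le>n. of_nat (n choose k) * (coeff_h f k * coeff_h g (n - k)))"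

instance
proof
  fix f g h :: "'a hurwitz"
  show "f * g * h = f * (g * h)"
  proof (rule hurwitz_eqI)
    fix n
    show "coeff_h (f * g * h) n = coeff_h (f * (g * h)) n"
      using binomial_convolution_assoc[of n "\<lambda>a b c. coeff_h f a * coeff_h g b * coeff_h h c"]
      by (simp add: times_hurwitz_def sum_distrib_left sum_distrib_right mult_ac)
  qed
  show "f * g = g * f"
    by (rule hurwitz_eqI, simp add: times_hurwitz_def, subst sum_atMost_reverse)
       (auto simp: mult_ac binomial_symmetric[symmetric] intro!: sum.cong)
  show "1 * f = f"
  proof (rule hurwitz_eqI)
    fix n
    have "coeff_h (1 * f) n = (\<Sum>k\<le>n. if k = 0 then coeff_h f n else 0)"
      unfolding times_hurwitz_def one_hurwitz_def
      by (simp add: if_distrib if_distribR cong: if_cong)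
    then show "coeff_h (1 * f) n = coeff_h f n" by simp
  qed
  show "(f + g) * h = f * h + g * h"
    by (rule hurwitz_eqI) (simp add: times_hurwitz_def plus_hurwitz_def algebra_simps sum.distrib)
  show "(0::'a hurwitz) \<noteq> 1"
    by (auto simp: zero_hurwitz_def one_hurwitz_def dest!: arg_cong[of _ _ "\<lambda>f. coeff_h f 0"])
qed (auto intro!: hurwitz_eqI simp: zero_hurwitz_def plus_hurwitz_def minus_hurwitz_def
      uminus_hurwitz_def algebra_simps)

end

lemma coeff_0 [simp]: "coeff_h 0 n = 0"
  and coeff_1: "coeff_h 1 n = (if n = 0 then 1 else 0)"
  and coeff_add [simp]: "coeff_h (f + g) n = coeff_h f n + coeff_h g n"
  and coeff_diff [simp]: "coeff_h (f - g) n = coeff_h f n - coeff_h g n"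
  and coeff_minus [simp]: "coeff_h (- f) n = - coeff_h f n"
  and coeff_mult: "coeff_h (f * g) n =
    (\<Sum>k\<le>n. of_nat (n choose k) * (coeff_h f k * coeff_h g (n - k)))"
  by (simp_all add: zero_hurwitz_def one_hurwitz_def plus_hurwitz_def minus_hurwitz_def
      uminus_hurwitz_def times_hurwitz_def)

lemma coeff_sum: "coeff_h (sum F S) n = (\<Sum>i\<in>S. coeff_h (F i) n)"
  by (induction S rule: infinite_finite_induct) auto

lemma coeff_of_nat_mult [simp]: "coeff_h (of_nat k * f) n = of_nat k * coeff_h f n"
  by (induction k) (auto simp: algebra_simps)

lemma coeff_numeral_mult [simp]: "coeff_h (numeral k * f) n = numeral k * coeff_h f n"
  using coeff_of_nat_mult[of "numeral k" f n] by simp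

text \<open>Applied twice, this lifts \<open>5 = 0\<close> from the field to
  \<open>'k hurwitz hurwitz\<close>.\<close>

lemma hurwitz_numeral_eq_0:
  "(numeral k :: 'a::comm_ring_1) = 0 \<Longrightarrow> (numeral k :: 'a hurwitz) = 0"
  by (rule hurwitz_eqI) (metis coeff_0 coeff_numeral_mult mult.right_neutral mult_zero_left)

section \<open>Derivations and splitting by residues modulo 5\<close>

definition deriv_h :: "'a hurwitz \<Rightarrow> 'a hurwitz" where
  "deriv_h f = Hurwitz (\<lambda>n. coeff_h f (Suc n))"

definition map_h :: "('a \<Rightarrow> 'b) \<Rightarrow> 'a hurwitz \<Rightarrow> 'b hurwitz" where
  "map_h u f = Hurwitz (\<lambda>n. u (coeff_h f n))"

text \<open>The \<open>r\<close>-th component of \<open>f\<close> when \<open>x\<^sup>(\<^sup>5\<^sup>m\<^sup>+\<^sup>r\<^sup>)\<close> is read as \<open>X\<^sup>(\<^sup>m\<^sup>) x\<^sup>(\<^sup>r\<^sup>)\<close>.\<close>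
definition component_h :: "nat \<Rightarrow> 'a hurwitz \<Rightarrow> 'a hurwitz" where
  "component_h r f = Hurwitz (\<lambda>m. coeff_h f (5 * m + r))"

lemma coeff_deriv [simp]: "coeff_h (deriv_h f) n = coeff_h f (Suc n)"
  and coeff_map [simp]: "coeff_h (map_h u f) n = u (coeff_h f n)"
  and coeff_component [simp]: "coeff_h (component_h r f) n = coeff_h f (5 * n + r)"
  by (simp_all add: deriv_h_def map_h_def component_h_def)

lemma deriv_h_linear:
  fixes f g :: "'a::comm_ring_1 hurwitz"
  shows "deriv_h (f + g) = deriv_h f + deriv_h g" "deriv_h (f - g) = deriv_h f - deriv_h g"
    "deriv_h (- f) = - deriv_h f" "deriv_h (numeral k * f) = numeral k * deriv_h f"
    "deriv_h (0 :: 'a hurwitz) = 0"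
  by (auto intro!: hurwitz_eqI)

lemma deriv_h_mult:
  fixes f g :: "'a::comm_ring_1 hurwitz"
  shows "deriv_h (f * g) = deriv_h f * g + f * deriv_h g"
proof (rule hurwitz_eqI)
  fix n
  show "coeff_h (deriv_h (f * g)) n = coeff_h (deriv_h f * g + f * deriv_h g) n"
    using pascal_convolution[of n "\<lambda>a b. coeff_h f a * coeff_h g b"]
    by (simp add: coeff_mult distrib_left sum.distrib)
qed

lemma map_deriv_h_linear:
  fixes f g :: "'a::comm_ring_1 hurwitz hurwitz"
  shows "map_h deriv_h (f + g) = map_h deriv_h f + map_h deriv_h g"
    "map_h deriv_h (f - g) = map_h deriv_h f - map_h deriv_h g"
    "map_h deriv_h (- f) = - map_h deriv_h f"
    "map_h deriv_h (numeral k * f) = numeral k * map_h deriv_h f"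
    "map_h deriv_h (0 :: 'a hurwitz hurwitz) = 0"
  by (auto intro!: hurwitz_eqI)

lemma map_deriv_h_mult:
  fixes f g :: "'a::comm_ring_1 hurwitz hurwitz"
  shows "map_h deriv_h (f * g) = map_h deriv_h f * g + f * map_h deriv_h g"
proof (rule hurwitz_eqI)
  have *: "deriv_h (sum F S) = (\<Sum>i\<in>S. deriv_h (F i))" for F :: "nat \<Rightarrow> 'a hurwitz" and S
    by (rule hurwitz_eqI) (simp add: coeff_sum)
  have **: "deriv_h (of_nat k :: 'a hurwitz) = 0" for k
    by (induction k) (auto intro!: hurwitz_eqI simp: deriv_h_linear coeff_1)
  fix n
  show "coeff_h (map_h deriv_h (f * g)) n = coeff_h (map_h deriv_h f * g + f * map_h deriv_h g) n"
    by (simp add: coeff_mult * ** deriv_h_mult distrib_left sum.distrib)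
qed

lemma map_deriv_h_commute:
  "map_h deriv_h (deriv_h f) = deriv_h (map_h deriv_h f)"
  by (auto intro!: hurwitz_eqI)

lemma component_h_linear:
  fixes f g :: "'a::comm_ring_1 hurwitz"
  shows "component_h r (f + g) = component_h r f + component_h r g"
    "component_h r (f - g) = component_h r f - component_h r g"
    "component_h r (- f) = - component_h r f"
    "component_h r (numeral k * f) = numeral k * component_h r f"
  by (auto intro!: hurwitz_eqI)

lemma component_h_deriv:
  "component_h 0 (deriv_h f) = component_h 1 f"
  "component_h 1 (deriv_h f) = component_h 2 f"
  "component_h 2 (deriv_h f) = component_h 3 f"
  "component_h 3 (deriv_h f) = component_h 4 f"
  "component_h 4 (deriv_h f) = deriv_h (component_h 0 f)"
  by (auto intro!: hurwitz_eqI simp: eval_nat_numeral)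

lemma component_h_map: "component_h r (map_h u f) = map_h u (component_h r f)"
  by (auto intro!: hurwitz_eqI)

text \<open>Coefficient \<open>n + 1\<close> of a product is coefficient \<open>n\<close> of its
  derivative, so the Leibniz rule moves each claim to the next residue. This uses the claim for
  \<open>deriv_h f\<close> and \<open>deriv_h g\<close>, hence the induction on \<open>m\<close>
  with \<open>f\<close>, \<open>g\<close> arbitrary.\<close>

lemma component_h_mult_aux:
  fixes f g :: "'a::comm_ring_1 hurwitz"
  assumes 5: "(5::'a hurwitz) = 0"
  defines "s \<equiv> component_h"
  shows
   "coeff_h (f * g) (5 * m) = coeff_h (s 0 f * s 0 g) m \<and>
    coeff_h (f * g) (5 * m + 1) = coeff_h (s 0 f * s 1 g + s 1 f * s 0 g) m \<and>
    coeff_h (f * g) (5 * m + 2) = coeff_h (s 0 f * s 2 g + 2 * (s 1 f * s 1 g) + s 2 f * s 0 g) m \<and>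
    coeff_h (f * g) (5 * m + 3) =
      coeff_h (s 0 f * s 3 g + 3 * (s 1 f * s 2 g) + 3 * (s 2 f * s 1 g) + s 3 f * s 0 g) m \<and>
    coeff_h (f * g) (5 * m + 4) =
      coeff_h (s 0 f * s 4 g + 4 * (s 1 f * s 3 g) + 6 * (s 2 f * s 2 g) + 4 * (s 3 f * s 1 g)
        + s 4 f * s 0 g) m" (is "?P0 f g m \<and> ?P1 f g m \<and> ?P2 f g m \<and> ?P3 f g m \<and> ?P4 f g m")
proof -
  have step: "coeff_h (f * g) n' = coeff_h (deriv_h f * g) n + coeff_h (f * deriv_h g) n"
    if "n' = Suc n" for f g :: "'a hurwitz" and n n'
    unfolding that using arg_cong[OF deriv_h_mult[of f g], of "\<lambda>h. coeff_h h n"] by simp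
  have *: "?P1 f g m \<and> ?P2 f g m \<and> ?P3 f g m \<and> ?P4 f g m" if P0: "\<And>f g. ?P0 f g m" for f g m
  proof -
    have P1: "?P1 f g m" for f g
      using step[of "5 * m + 1" "5 * m" f g] unfolding P0 coeff_add[symmetric]
      by (simp add: s_def component_h_deriv algebra_simps
          del: One_nat_def coeff_add coeff_numeral_mult)
    have P2: "?P2 f g m" for f g
      using step[of "5 * m + 2" "5 * m + 1" f g] unfolding P1 coeff_add[symmetric]
      by (simp add: s_def component_h_deriv algebra_simps
          del: One_nat_def coeff_add coeff_numeral_mult)
    have P3: "?P3 f g m" for f g
      using step[of "5 * m + 3" "5 * m + 2" f g] unfolding P2 coeff_add[symmetric]
      by (simp add: s_def component_h_deriv algebra_simps
          del: One_nat_def coeff_add coeff_numeral_mult)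
    have P4: "?P4 f g m" for f g
      using step[of "5 * m + 4" "5 * m + 3" f g] unfolding P3 coeff_add[symmetric]
      by (simp add: s_def component_h_deriv algebra_simps
          del: One_nat_def coeff_add coeff_numeral_mult)
    show ?thesis using P1 P2 P3 P4 by blast
  qed
  have "?P0 f g m" for f g
  proof (induction m arbitrary: f g)
    case 0
    show ?case by (simp add: coeff_mult s_def)
  next
    case (Suc m)
    have P4: "?P4 f g m" for f g using *[OF Suc] by blast
    have "(10::'a hurwitz) = 5 + 5" by simp
    then have 10: "(10::'a hurwitz) = 0" by (simp only: 5 add_0_left)
    \<comment> \<open>The fifth differentiation yields row 5 of Pascal's triangle. The inner entries
      5, 10, 10, 5 vanish, and the outer two terms combine to the derivative of
      \<open>s 0 f * s 0 g\<close>.\<close>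
    have "coeff_h (f * g) (5 * Suc m) =
        coeff_h (deriv_h (s 0 f * s 0 g) + 5 * (s 1 f * s 4 g) + 10 * (s 2 f * s 3 g)
          + 10 * (s 3 f * s 2 g) + 5 * (s 4 f * s 1 g)) m"
      using step[of "5 * Suc m" "5 * m + 4" f g] unfolding P4 coeff_add[symmetric]
      by (simp add: s_def component_h_deriv deriv_h_mult algebra_simps
          del: One_nat_def coeff_add coeff_numeral_mult)
    then show ?case by (simp add: 5 10 deriv_h_linear del: coeff_numeral_mult)
  qed
  with * show ?thesis by blast
qed

lemma component_h_mult:
  fixes f g :: "'a::comm_ring_1 hurwitz"
  assumes "(5::'a hurwitz) = 0"
  shows
   "component_h 0 (f * g) = component_h 0 f * component_h 0 g"
   "component_h 1 (f * g) = component_h 0 f * component_h 1 g + component_h 1 f * component_h 0 g"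
   "component_h 2 (f * g) =
      component_h 0 f * component_h 2 g + 2 * (component_h 1 f * component_h 1 g)
      + component_h 2 f * component_h 0 g"
   "component_h 3 (f * g) =
      component_h 0 f * component_h 3 g + 3 * (component_h 1 f * component_h 2 g)
      + 3 * (component_h 2 f * component_h 1 g) + component_h 3 f * component_h 0 g"
   "component_h 4 (f * g) =
      component_h 0 f * component_h 4 g + 4 * (component_h 1 f * component_h 3 g)
      + 6 * (component_h 2 f * component_h 2 g) + 4 * (component_h 3 f * component_h 1 g)
      + component_h 4 f * component_h 0 g"
  using component_h_mult_aux[OF assms, of f g]
  by (auto intro!: hurwitz_eqI)

section \<open>The Jacobi identity for the deformed bracket\<close>

text \<open>\<open>p\<close> and \<open>q\<close> stand for the derivations in \<open>x\<close> and
  \<open>y\<close>. Naming the fifth power of \<open>p\<close> as \<open>d\<close> bounds the powers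
  of \<open>p\<close> in normal forms, so the Jacobi identity becomes a polynomial identity.\<close>

locale char5_derivations =
  fixes p q d :: "'a::comm_ring_1 \<Rightarrow> 'a" and x :: 'a
  assumes five: "(5::'a) = 0"
    and p_add: "p (f + g) = p f + p g" and p_mult: "p (f * g) = p f * g + f * p g"
    and q_add: "q (f + g) = q f + q g" and q_mult: "q (f * g) = q f * g + f * q g"
    and q_p: "q (p f) = p (q f)"
    and p5: "p (p (p (p (p f)))) = d f"
    and p_x: "p x = 1" and q_x: "q x = 0"
begin

definition "N f = f - x * p f"

lemma N_add: "N (f + g) = N f + N g" and N_mult: "N (f * g) = N f * g + f * N g - f * g"
  by (simp_all add: N_def p_add p_mult algebra_simps)

lemma zero: "p 0 = 0" "q 0 = 0" "N 0 = 0"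
  using p_add[of 0 0] q_add[of 0 0] N_add[of 0 0] by auto

lemma minus: "p (- f) = - p f" "q (- f) = - q f" "N (- f) = - N f"
  using p_add[of f "- f"] q_add[of f "- f"] N_add[of f "- f"]
  by (simp_all add: zero add_eq_0_iff)

lemma diff: "p (f - g) = p f - p g" "q (f - g) = q f - q g" "N (f - g) = N f - N g"
  using p_add[of f "- g"] q_add[of f "- g"] N_add[of f "- g"] by (simp_all add: minus)

lemma p_numeral: "p (numeral k) = 0"
  and q_numeral: "q (numeral k) = 0"
  and N_numeral: "N (numeral k) = numeral k"
proof -
  have "p 1 = 0" "q 1 = 0" "N 1 = 1"
    using p_mult[of 1 1] q_mult[of 1 1] N_mult[of 1 1] by (simp_all add: algebra_simps)
  then show "p (numeral k) = 0" "q (numeral k) = 0" "N (numeral k) = numeral k"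
    by (induction k) (simp_all only: numeral.simps p_add q_add N_add add_0_right)
qed

lemma p_N: "p (N f) = - (x * p (p f))" and q_N: "q (N f) = N (q f)"
  by (simp_all add: N_def diff p_mult q_mult p_x q_x q_p)

lemma N_p: "N (p f) = p (N f) + p f"
  unfolding p_N by (simp add: N_def)

lemma d_p: "d (p f) = p (d f)" and d_q: "d (q f) = q (d f)"
  by (simp_all add: q_p flip: p5)

text \<open>Moving \<open>p\<close> past \<open>N\<close> costs one extra \<open>p\<close>; five
  moves cost \<open>5 * d f\<close>, which is 0.\<close>

lemma d_N: "d (N f) = N (d f)"
proof -
  have pN: "p (N f) = N (p f) - p f" for f by (simp add: N_p)
  have "p (p (p (p (p (N f))))) = N (p (p (p (p (p f))))) - 5 * p (p (p (p (p f))))"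
    by (simp add: pN diff p_add p_mult p_numeral algebra_simps)
  then show ?thesis by (simp add: five p5)
qed

lemma d_x: "d x = 0"
  using p_numeral[of Num.One] by (simp add: p_x zero flip: p5)

text \<open>Residues are taken in \<open>-2, \<dots>, 2\<close> so that the simplifier can cancel opposite terms.\<close>

lemma char5: "(3::'a) = - 2" "(4::'a) = - 1" "(5::'a) = 0" "(6::'a) = 1" "(7::'a) = 2"
  "(8::'a) = - 2" "(9::'a) = - 1" "(10::'a) = 0" "(11::'a) = 1" "(12::'a) = 2"
proof -
  have *: "f = g" if "f - g = 5 \<or> f - g = 10" for f g :: 'a
  proof -
    have "(10::'a) = 5 + 5" by simp
    then have "(10::'a) = 0" by (simp only: five add_0_right)
    then show ?thesis using that five by auto
  qed
  show "(3::'a) = - 2" "(4::'a) = - 1" "(5::'a) = 0" "(6::'a) = 1" "(7::'a) = 2"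
    "(8::'a) = - 2" "(9::'a) = - 1" "(10::'a) = 0" "(11::'a) = 1" "(12::'a) = 2"
    by (rule *, simp)+
qed

text \<open>The fifth power of a derivation is a derivation in characteristic 5, as the binomials 5
  and 10 vanish.\<close>

lemma d_add: "d (f + g) = d f + d g" and d_diff: "d (f - g) = d f - d g"
  and d_mult: "d (f * g) = d f * g + f * d g"
proof -
  have "p (p (p (p (p (f * g))))) = p (p (p (p (p f)))) * g + f * p (p (p (p (p g))))
     + 5 * (p (p (p (p f))) * p g + p f * p (p (p (p g))))
     + 10 * (p (p (p f)) * p (p g) + p (p f) * p (p (p g)))"
    by (simp add: p_mult p_add p_numeral algebra_simps)
  then show "d (f * g) = d f * g + f * d g"
    by (simp add: p5 char5)
qed (simp_all add: p_add diff flip: p5)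

definition "P a b = p a * q b - q a * p b"
definition "\<phi> a b = p (p a) * p (p (p b)) - p (p (p a)) * p (p b)"
definition "\<psi> a b = N a * d b - d a * N b"

lemmas ders = p_add q_add N_add d_add diff d_diff p_mult q_mult N_mult d_mult minus
  p_numeral q_numeral N_numeral q_p d_p d_q d_N N_p q_N p5

lemma jacobi_P: "P (P a b) c + P (P b c) a + P (P c a) b = 0"
  unfolding P_def by (simp add: ders) (simp add: algebra_simps)

text \<open>The term \<open>- f * g\<close> in \<open>N_mult\<close> is cancelled by the extra
  \<open>p f\<close> in \<open>N_p\<close>, so \<open>N\<close> is a derivation of \<open>P\<close>
  though not of the product.\<close>

lemma N_P: "N (P a b) = P (N a) b + P a (N b)"
  and d_P: "d (P a b) = P (d a) b + P a (d b)"
  unfolding P_def by (simp_all add: ders algebra_simps)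

lemma cocycle_\<psi>: "P (\<psi> a b) c + P (\<psi> b c) a + P (\<psi> c a) b
   + \<psi> (P a b) c + \<psi> (P b c) a + \<psi> (P c a) b = 0"
  unfolding \<psi>_def N_P d_P unfolding P_def by (simp add: ders) (simp add: algebra_simps)

lemma cocycle_\<phi>: "P (\<phi> a b) c + P (\<phi> b c) a + P (\<phi> c a) b
   + \<phi> (P a b) c + \<phi> (P b c) a + \<phi> (P c a) b = 0"
  unfolding \<phi>_def P_def by (simp add: ders) (simp add: algebra_simps char5)

text \<open>Here \<open>N\<close> cannot stay opaque: the identity needs that all \<open>p (N f)\<close> share the factor \<open>x\<close>.\<close>

lemma obstruction_\<phi>\<psi>: "\<phi> (\<phi> a b) c + \<phi> (\<phi> b c) a + \<phi> (\<phi> c a) b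
   + 2 * (\<psi> (\<phi> a b) c + \<psi> (\<phi> b c) a + \<psi> (\<phi> c a) b +
     \<phi> (\<psi> a b) c + \<phi> (\<psi> b c) a + \<phi> (\<psi> c a) b) = 0"
  unfolding \<phi>_def \<psi>_def by (simp add: ders p_N p_x q_x d_x) (simp add: algebra_simps char5)

text \<open>For commuting derivations this is the usual Jacobi identity. The defect of
  \<open>N\<close> adds only \<open>- \<psi> a b * d c\<close>, whose cyclic sum is 0.\<close>

lemma obstruction_\<psi>: "\<psi> (\<psi> a b) c + \<psi> (\<psi> b c) a + \<psi> (\<psi> c a) b = 0"
  unfolding \<psi>_def by (simp add: ders) (simp add: algebra_simps char5)

definition "\<beta> a b = P a b + \<phi> a b + 2 * \<psi> a b"

text \<open>Terms are sorted by the pair of brackets composed. All groups but one vanish whatever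
  the coefficient of \<open>\<psi>\<close>; in \<open>obstruction_\<phi>\<psi>\<close> the
  coefficient 2 balances \<open>\<phi>\<close> with itself against the mixed terms.\<close>

lemma jacobi: "\<beta> (\<beta> a b) c + \<beta> (\<beta> b c) a + \<beta> (\<beta> c a) b = 0"
proof -
  have add: "P (f + g) c = P f c + P g c" "\<phi> (f + g) c = \<phi> f c + \<phi> g c"
    "\<psi> (f + g) c = \<psi> f c + \<psi> g c" for f g c
    by (simp_all add: P_def \<phi>_def \<psi>_def ders algebra_simps)
  have two: "P (2 * f) c = 2 * P f c" "\<phi> (2 * f) c = 2 * \<phi> f c" "\<psi> (2 * f) c = 2 * \<psi> f c" for f c
    using add[of f f c] by (simp_all flip: mult_2)
  have "\<beta> (\<beta> a b) c + \<beta> (\<beta> b c) a + \<beta> (\<beta> c a) b =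
    (P (P a b) c + P (P b c) a + P (P c a) b) +
    (P (\<phi> a b) c + P (\<phi> b c) a + P (\<phi> c a) b + \<phi> (P a b) c + \<phi> (P b c) a + \<phi> (P c a) b) +
    2 * (P (\<psi> a b) c + P (\<psi> b c) a + P (\<psi> c a) b + \<psi> (P a b) c + \<psi> (P b c) a + \<psi> (P c a) b) +
    (\<phi> (\<phi> a b) c + \<phi> (\<phi> b c) a + \<phi> (\<phi> c a) b
      + 2 * (\<psi> (\<phi> a b) c + \<psi> (\<phi> b c) a + \<psi> (\<phi> c a) b +
         \<phi> (\<psi> a b) c + \<phi> (\<psi> b c) a + \<phi> (\<psi> c a) b)) +
    4 * (\<psi> (\<psi> a b) c + \<psi> (\<psi> b c) a + \<psi> (\<psi> c a) b)"
    unfolding \<beta>_def add two by (simp add: algebra_simps)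
  then show ?thesis
    unfolding jacobi_P cocycle_\<phi> cocycle_\<psi> obstruction_\<phi>\<psi> obstruction_\<psi> by simp
qed

end

section \<open>Transport of Lie algebra structures\<close>

lemma lie_algebra_transport:
  assumes A: "lie_algebra s1 L1 b1" and V: "vector_space s2" and S: "module.subspace s2 L2"
    and h: "bij_betw h L1 L2"
    and add: "\<And>a b. a \<in> L1 \<Longrightarrow> b \<in> L1 \<Longrightarrow> h (a + b) = h a + h b"
    and scale: "\<And>t a. a \<in> L1 \<Longrightarrow> h (s1 t a) = s2 t (h a)"
    and br: "\<And>a b. a \<in> L1 \<Longrightarrow> b \<in> L1 \<Longrightarrow> h (b1 a b) = b2 (h a) (h b)"
  shows "lie_algebra s2 L2 b2"
proof -
  interpret A: lie_algebra s1 L1 b1 by (rule A)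
  interpret V: vector_space s2 by (rule V)
  have L2: "L2 = h ` L1" using h by (simp add: bij_betw_def)
  note cl = A.br_closed A.subspace_add[OF A.subspace_carrier] A.subspace_scale[OF A.subspace_carrier]
  have h0: "h 0 = 0"
    using scale[of 0 0] A.subspace_0[OF A.subspace_carrier] by simp
  show ?thesis
  proof unfold_locales
    show "V.subspace L2" by (rule S)
  \<comment> \<open>Every element of \<open>L2\<close> is an image under \<open>h\<close>; the
    flipped rules then pull \<open>h\<close> outward until an axiom of \<open>L1\<close> applies
    inside it.\<close>
  qed (auto simp: L2 cl h0 A.br_add_left A.br_add_right A.br_scale_left A.br_scale_right
      A.br_alternating A.br_jacobi simp flip: add scale br)
qed

lemma lie_isomorphicI:
  assumes A: "lie_algebra s1 L1 b1" and V: "vector_space s2" and S: "module.subspace s2 L2"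
    and h: "bij_betw h L1 L2"
    and add: "\<And>a b. a \<in> L1 \<Longrightarrow> b \<in> L1 \<Longrightarrow> h (a + b) = h a + h b"
    and scale: "\<And>t a. a \<in> L1 \<Longrightarrow> h (s1 t a) = s2 t (h a)"
    and br: "\<And>a b. a \<in> L1 \<Longrightarrow> b \<in> L1 \<Longrightarrow> h (b1 a b) = b2 (h a) (h b)"
  shows "lie_isomorphic s1 L1 b1 s2 L2 b2"
  unfolding lie_isomorphic_def
proof (intro conjI exI[of _ h] allI ballI)
  show "lie_algebra s2 L2 b2"
    by (rule lie_algebra_transport[OF A V S h]) (fact add scale br)+
qed (fact A h add scale br)+

section \<open>Divided powers algebras inside Hurwitz series\<close>

text \<open>Keeps the literal \<open>1\<close> in \<open>dp_carrier 1 1\<close> and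
  \<open>component_h 1\<close> from becoming \<open>Suc 0\<close>.\<close>

declare One_nat_def [simp del]

definition to_hurwitz :: "'k::field dp \<Rightarrow> 'k hurwitz hurwitz" where
  "to_hurwitz f = Hurwitz (\<lambda>i. Hurwitz (f i))"

lemma coeff_to_hurwitz [simp]: "coeff_h (coeff_h (to_hurwitz f) i) j = f i j"
  by (simp add: to_hurwitz_def)

lemma hurwitz2_eqI:
  "(\<And>i j. coeff_h (coeff_h f i) j = coeff_h (coeff_h g i) j) \<Longrightarrow> f = g"
  by (intro hurwitz_eqI) auto

lemma to_hurwitz_inject: "to_hurwitz f = to_hurwitz g \<longleftrightarrow> f = g"
proof
  assume "to_hurwitz f = to_hurwitz g"
  then have "coeff_h (coeff_h (to_hurwitz f) i) j = coeff_h (coeff_h (to_hurwitz g) i) j" for i j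
    by simp
  then show "f = g" by (simp add: fun_eq_iff)
qed simp

lemma to_hurwitz_linear:
  "to_hurwitz (f + g) = to_hurwitz f + to_hurwitz g"
  "to_hurwitz (f - g) = to_hurwitz f - to_hurwitz g"
  "to_hurwitz (- f) = - to_hurwitz f"
  "to_hurwitz (dp_scale (numeral k) f) = numeral k * to_hurwitz f"
  by (auto intro!: hurwitz2_eqI simp: dp_scale_def)

lemma to_hurwitz_d1: "to_hurwitz (dp_d1 f) = deriv_h (to_hurwitz f)"
  and to_hurwitz_d2: "to_hurwitz (dp_d2 f) = map_h deriv_h (to_hurwitz f)"
  by (auto intro!: hurwitz2_eqI simp: dp_d1_def dp_d2_def)

text \<open>Here \<open>k\<close> and \<open>n - k\<close> are both below
  \<open>CHAR('k) ^ m\<close> but their sum is not: a carry. Pascal's rule preserves these bounds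
  going down from row \<open>CHAR('k) ^ m\<close>.\<close>

lemma of_nat_choose_eq_0:
  assumes p: "prime CHAR('k::field)"
    and n: "CHAR('k) ^ m \<le> n" "k < CHAR('k) ^ m" "n < k + CHAR('k) ^ m"
  shows "of_nat (n choose k) = (0 :: 'k)"
  using n
proof (induction n arbitrary: k rule: dec_induct)
  case base
  then show ?case using of_nat_choose_CHAR_power_eq_0[OF p] by simp
next
  case (step n)
  then obtain l where "k = Suc l" by (cases k) auto
  with step show ?case by simp
qed

lemma to_hurwitz_mult:
  fixes f g :: "'k::field dp"
  assumes p: "prime CHAR('k)" and f: "f \<in> dp_carrier m1 m2" and g: "g \<in> dp_carrier m1 m2"
  shows "to_hurwitz (dp_mult m1 m2 f g) = to_hurwitz f * to_hurwitz g"
proof (rule hurwitz2_eqI)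
  fix i j
  have *: "of_nat (n choose k) = (0::'k) \<or> \<not> k < CHAR('k) ^ m \<or> \<not> n - k < CHAR('k) ^ m"
    if "\<not> n < CHAR('k) ^ m" for n k m
    using of_nat_choose_eq_0[OF p, of m n k] that by linarith
  have "of_nat (i choose a) * of_nat (j choose b) * f a b * g (i - a) (j - b) = 0"
    if "\<not> (i < CHAR('k) ^ m1 \<and> j < CHAR('k) ^ m2)" for a b
    using that f g *[of i m1 a] *[of j m2 b] unfolding dp_carrier_def mem_Collect_eq
    by (metis mult_zero_left mult_zero_right)
  then have "dp_mult m1 m2 f g i j = (\<Sum>a\<le>i. \<Sum>b\<le>j.
      of_nat (i choose a) * of_nat (j choose b) * f a b * g (i - a) (j - b))"
    unfolding dp_mult_def by (simp add: sum.neutral)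
  then show "coeff_h (coeff_h (to_hurwitz (dp_mult m1 m2 f g)) i) j =
      coeff_h (coeff_h (to_hurwitz f * to_hurwitz g) i) j"
    unfolding coeff_mult[of "to_hurwitz f"] coeff_sum coeff_of_nat_mult coeff_mult[of "coeff_h _ _"]
    by (simp add: sum_distrib_left mult_ac)
qed

lemma dp_carrier_add: "f \<in> dp_carrier m1 m2 \<Longrightarrow> g \<in> dp_carrier m1 m2 \<Longrightarrow> f + g \<in> dp_carrier m1 m2"
  and dp_carrier_diff: "f \<in> dp_carrier m1 m2 \<Longrightarrow> g \<in> dp_carrier m1 m2 \<Longrightarrow> f - g \<in> dp_carrier m1 m2"
  and dp_carrier_minus: "f \<in> dp_carrier m1 m2 \<Longrightarrow> - f \<in> dp_carrier m1 m2"
  and dp_carrier_scale: "f \<in> dp_carrier m1 m2 \<Longrightarrow> dp_scale t f \<in> dp_carrier m1 m2"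
  and dp_carrier_mult: "dp_mult m1 m2 f g \<in> dp_carrier m1 m2"
  unfolding dp_carrier_def dp_scale_def dp_mult_def
      apply (clarsimp, metis add_0)
     apply (clarsimp, metis diff_0_right)
    apply auto
  done

lemmas dp_carrier_closed = dp_carrier_add dp_carrier_diff dp_carrier_minus dp_carrier_scale
  dp_carrier_mult dp_d1_carrier dp_d2_carrier

lemma vector_space_dp_scale: "vector_space (dp_scale :: 'k::field \<Rightarrow> 'k dp \<Rightarrow> 'k dp)"
  by unfold_locales (auto simp: dp_scale_def fun_eq_iff algebra_simps)

lemma subspace_dp_carrier: "module.subspace dp_scale (dp_carrier m1 m2 :: 'k::field dp set)"
proof -
  interpret vector_space "dp_scale :: 'k \<Rightarrow> 'k dp \<Rightarrow> 'k dp" by (rule vector_space_dp_scale)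
  show ?thesis
    by (rule subspaceI) (auto simp: dp_carrier_add dp_carrier_scale, auto simp: dp_carrier_def)
qed

lemma vector_space_mel_scale: "vector_space (mel_scale :: 'k::field \<Rightarrow> 'k mel \<Rightarrow> 'k mel)"
  by unfold_locales
    (auto simp: mel_scale_def vf_scale_def dp_scale_def fun_eq_iff algebra_simps)

lemma subspace_mel_carrier: "module.subspace mel_scale (mel_carrier :: 'k::field mel set)"
proof -
  interpret vector_space "mel_scale :: 'k \<Rightarrow> 'k mel \<Rightarrow> 'k mel" by (rule vector_space_mel_scale)
  have "(0 :: 'k dp) \<in> dp_carrier 1 1" by (simp add: dp_carrier_def)
  then show ?thesis
    by (intro subspaceI) (auto simp: mel_carrier_def mel_scale_def vf_scale_def zero_prod_def
       intro: dp_carrier_closed)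
qed

lemma dp_d1_scale: "dp_d1 (dp_scale t f) = dp_scale t (dp_d1 f)"
  and dp_d2_scale: "dp_d2 (dp_scale t f) = dp_scale t (dp_d2 f)"
  by (auto simp: dp_d1_def dp_d2_def dp_scale_def)

lemma dp_mult_scale: "dp_mult m1 m2 (dp_scale t f) g = dp_scale t (dp_mult m1 m2 f g)"
  "dp_mult m1 m2 g (dp_scale t f) = dp_scale t (dp_mult m1 m2 g f)"
  by (auto simp: dp_mult_def dp_scale_def fun_eq_iff sum_distrib_left mult_ac)

lemma dp_scale_add: "dp_scale t (f + g) = dp_scale t f + dp_scale t g"
  and dp_scale_diff: "dp_scale t (f - g) = dp_scale t f - dp_scale t g"
  and dp_scale_commute: "dp_scale t (dp_scale s f) = dp_scale s (dp_scale t f)"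
  by (auto simp: dp_scale_def fun_eq_iff algebra_simps)

lemma deformed_bracket_commute: "deformed_bracket b a = - deformed_bracket a b"
  unfolding deformed_bracket_def poisson_bracket_def phi_def psi_def
  by (simp add: dp_mult_commute[of _ _ _ "dp_d1 b"] dp_mult_commute[of _ _ _ "dp_d2 b"]
      dp_mult_commute[of _ _ _ "(dp_d1 ^^ k) b" for k]
      dp_mult_commute[of _ _ _ "id_minus_xdx b"] dp_scale_diff)

lemma funpow_d1: "(dp_d1 ^^ k) (f + g) = (dp_d1 ^^ k) f + (dp_d1 ^^ k) g"
  "(dp_d1 ^^ k) (dp_scale t f) = dp_scale t ((dp_d1 ^^ k) f)"
  by (induction k) (auto simp: dp_d1_add dp_d1_scale)

lemma deformed_bracket_linear:
  "deformed_bracket (a + b) c = deformed_bracket a c + deformed_bracket b c"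
  "deformed_bracket (dp_scale t a) c = dp_scale t (deformed_bracket a c)"
  unfolding deformed_bracket_def poisson_bracket_def phi_def psi_def id_minus_xdx_def
  by (simp_all add: dp_d1_add dp_d2_add dp_d1_scale dp_d2_scale funpow_d1
    dp_mult_add_left dp_mult_add_right dp_mult_diff_left dp_mult_scale dp_scale_add dp_scale_diff
    dp_scale_commute[of 2 t])

section \<open>The map to the Melikyan algebra\<close>

definition dp_component :: "nat \<Rightarrow> 'k::field dp \<Rightarrow> 'k dp" where
  "dp_component r a = (\<lambda>m j. a (5 * m + r) j)"

definition melikyan_map :: "'k::field dp \<Rightarrow> 'k mel" where
  "melikyan_map a =
    (dp_scale 3 (dp_component 2 a),
     (dp_scale 2 (dp_component 0 a), dp_component 1 a),
     (dp_scale 4 (dp_component 3 a), dp_scale 2 (dp_component 4 a + dp_d2 (dp_component 0 a))))"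

lemma to_hurwitz_component: "to_hurwitz (dp_component r a) = component_h r (to_hurwitz a)"
  by (auto intro!: hurwitz2_eqI simp: dp_component_def)

lemma dp_component_carrier:
  assumes "CHAR('k::field) = 5" "r < 5" "a \<in> (dp_carrier 2 1 :: 'k dp set)"
  shows "dp_component r a \<in> dp_carrier 1 1"
  using assms unfolding dp_carrier_def dp_component_def by fastforce

lemma melikyan_map_linear:
  "melikyan_map (a + b) = melikyan_map a + melikyan_map b"
  "melikyan_map (dp_scale t a) = mel_scale t (melikyan_map a)"
  by (auto simp: melikyan_map_def mel_scale_def vf_scale_def dp_component_def dp_d2_def
      dp_scale_def fun_eq_iff algebra_simps)

text \<open>Evaluates the factor \<open>x\<close> in \<open>\<psi>\<close> on components.\<close>

lemma component_h_monom:
  fixes X :: "'k::field hurwitz hurwitz"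
  defines "X \<equiv> to_hurwitz (dp_monom 1 0)"
  shows "component_h 0 X = 0" "component_h 1 X = 1" "component_h 2 X = 0"
    "component_h 3 X = 0" "component_h 4 X = 0"
  by (auto intro!: hurwitz2_eqI simp: X_def dp_monom_def coeff_1)

section \<open>Brackets computed in the Hurwitz ring\<close>

context
  assumes char: "CHAR('k::field) = 5"
begin

lemma prime_char: "prime CHAR('k)"
  by (simp add: char)

lemma five_eq_0: "(5::'k) = 0"
  using of_nat_CHAR[where 'a = 'k] by (simp add: char)

abbreviation "X \<equiv> to_hurwitz (dp_monom 1 0 :: 'k dp)"

lemma char5_derivations:
  "char5_derivations deriv_h (map_h deriv_h)
     (\<lambda>f. deriv_h (deriv_h (deriv_h (deriv_h (deriv_h f))))) X"
proof unfold_locales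
  show "(5 :: 'k hurwitz hurwitz) = 0"
    by (intro hurwitz_numeral_eq_0 five_eq_0)
  show "deriv_h X = 1" "map_h deriv_h X = 0"
    by (auto intro!: hurwitz2_eqI simp: dp_monom_def coeff_1)
qed (simp_all add: deriv_h_linear deriv_h_mult map_deriv_h_linear map_deriv_h_mult
    map_deriv_h_commute)

interpretation D: char5_derivations deriv_h "map_h deriv_h"
  "\<lambda>f. deriv_h (deriv_h (deriv_h (deriv_h (deriv_h f))))" X
  by (rule char5_derivations)

lemma deformed_bracket_carrier: "deformed_bracket a b \<in> (dp_carrier 2 1 :: 'k dp set)"
  unfolding deformed_bracket_def poisson_bracket_def phi_def psi_def
  by (intro dp_carrier_closed)

lemma to_hurwitz_deformed_bracket:
  assumes "a \<in> (dp_carrier 2 1 :: 'k dp set)" "b \<in> dp_carrier 2 1"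
  shows "to_hurwitz (deformed_bracket a b) = D.\<beta> (to_hurwitz a) (to_hurwitz b)"
proof -
  have x: "dp_monom 1 0 \<in> (dp_carrier 2 1 :: 'k dp set)"
    by (auto simp: dp_carrier_def dp_monom_def char)
  have funpow: "(F ^^ 2) f = F (F f)" "(F ^^ 3) f = F (F (F f))" "(F ^^ 5) f = F (F (F (F (F f))))"
    for F :: "'k dp \<Rightarrow> 'k dp" and f
    by (simp_all add: eval_nat_numeral One_nat_def)
  show ?thesis
    unfolding deformed_bracket_def poisson_bracket_def phi_def psi_def id_minus_xdx_def
      D.\<beta>_def D.P_def D.\<phi>_def D.\<psi>_def D.N_def
    using assms
    by (simp only: funpow to_hurwitz_linear to_hurwitz_mult[OF prime_char] to_hurwitz_d1
        to_hurwitz_d2 dp_carrier_closed x)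
qed

lemma lie_algebra_deformed:
  "lie_algebra dp_scale (dp_carrier 2 1 :: 'k dp set) deformed_bracket"
proof -
  interpret vector_space "dp_scale :: 'k \<Rightarrow> 'k dp \<Rightarrow> 'k dp" by (rule vector_space_dp_scale)
  show ?thesis
  proof unfold_locales
    fix a b c :: "'k dp" and t :: 'k
    assume a: "a \<in> dp_carrier 2 1"
    have "to_hurwitz (deformed_bracket a a) = 0"
      by (simp add: to_hurwitz_deformed_bracket a D.\<beta>_def D.P_def D.\<phi>_def D.\<psi>_def mult.commute)
    also have "\<dots> = to_hurwitz 0" by (auto intro!: hurwitz2_eqI)
    finally show "deformed_bracket a a = 0" by (simp only: to_hurwitz_inject)
    assume b: "b \<in> dp_carrier 2 1" and c: "c \<in> dp_carrier 2 1"
    show "deformed_bracket (deformed_bracket a b) c + deformed_bracket (deformed_bracket b c) a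
       + deformed_bracket (deformed_bracket c a) b = 0"
      unfolding to_hurwitz_inject[symmetric]
      using D.jacobi[of "to_hurwitz a" "to_hurwitz b" "to_hurwitz c"]
      by (simp add: to_hurwitz_deformed_bracket a b c deformed_bracket_carrier to_hurwitz_linear)
         (auto intro!: hurwitz2_eqI)
    show "deformed_bracket a (b + c) = deformed_bracket a b + deformed_bracket a c"
      "deformed_bracket a (dp_scale t b) = dp_scale t (deformed_bracket a b)"
      unfolding deformed_bracket_commute[of a] deformed_bracket_linear
      by (auto simp: dp_scale_def fun_eq_iff)
  qed (auto simp: subspace_dp_carrier deformed_bracket_carrier deformed_bracket_linear)
qed

lemma melikyan_map_bracket:
  assumes a: "a \<in> (dp_carrier 2 1 :: 'k dp set)" and b: "b \<in> dp_carrier 2 1"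
  shows "melikyan_map (deformed_bracket a b) = mel_bracket (melikyan_map a) (melikyan_map b)"
proof -
  note sec = dp_component_carrier[OF char _ a] dp_component_carrier[OF char _ b]
  note H = to_hurwitz_linear to_hurwitz_component to_hurwitz_d1 to_hurwitz_d2
    to_hurwitz_mult[OF prime_char, of _ 1 1] to_hurwitz_deformed_bracket[OF a b]
  note S = component_h_linear component_h_deriv component_h_map component_h_mult[OF D.five]
    component_h_monom
  note L = deriv_h_linear map_deriv_h_linear deriv_h_mult map_deriv_h_mult map_deriv_h_commute
     D.p_numeral D.q_numeral
  show ?thesis
    unfolding melikyan_map_def mel_bracket_def split mel_act_fun_def mel_act_tilde_def
      vf_apply_def vf_mult_def vf_scale_def vf_bracket_def vf_div_def vf_ham_def fst_conv snd_conv
      add_Pair diff_Pair prod.inject to_hurwitz_inject[symmetric]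
    apply (simp only: H dp_carrier_closed sec rel_simps)
    \<comment> \<open>\<open>mult_2\<close> turns \<open>2 * \<psi>\<close> into a sum, since
      \<open>component_h_mult\<close> would also match it as a product.\<close>
    unfolding D.\<beta>_def D.P_def D.\<phi>_def D.\<psi>_def D.N_def mult_2
    apply (simp only: S)
    \<comment> \<open>Five differential polynomial identities remain, one per copy of the small
      algebra; \<open>D.char5\<close> reduces their coefficients modulo 5.\<close>
    by (intro conjI; simp add: L algebra_simps D.char5)
qed

end

section \<open>Bijectivity\<close>

lemma bij_betw_melikyan_map:
  assumes char: "CHAR('k::field) = 5"
  shows "bij_betw melikyan_map (dp_carrier 2 1 :: 'k dp set) mel_carrier"
proof -
  \<comment> \<open>The inverse: modulo 5, 2 and 3 are mutually inverse and 4 is its own inverse.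
    The term with \<open>Suc j\<close> removes the correction, as component 0 is
    \<open>3 * D1\<close>.\<close>
  define g :: "'k mel \<Rightarrow> 'k dp" where "g = (\<lambda>(f, (D1, D2), (E1, E2)) i j.
    let m = i div 5; r = i mod 5 in
      if r = 0 then 3 * D1 m j else if r = 1 then D2 m j else if r = 2 then 2 * f m j
      else if r = 3 then 4 * E1 m j else 3 * E2 m j - 3 * D1 m (Suc j))"
  have five: "(5::'k) = 0" by (rule five_eq_0[OF char])
  \<comment> \<open>These are the products 2 * 3 and 4 * 4 of the constants with their
    inverses.\<close>
  have "(6::'k) = 5 + 1" "(16::'k) = 5 + 5 + 5 + 1" by simp_all
  then have *: "(6::'k) = 1" "(16::'k) = 1"
    by (simp_all only: five add_0_left)
  have mem: "melikyan_map a \<in> mel_carrier" if "a \<in> dp_carrier 2 1" for a :: "'k dp"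
    using that by (auto simp: melikyan_map_def mel_carrier_def intro!: dp_carrier_closed
        dp_component_carrier[OF char])
  show ?thesis
  proof (rule bij_betw_byWitness[where f' = g])
    show "\<forall>a\<in>dp_carrier 2 1. g (melikyan_map a) = a"
    proof (intro ballI ext)
      fix a :: "'k dp" and i j :: nat
      have i: "i = 5 * (i div 5) + i mod 5" by simp
      have "i mod 5 < 5" by simp
      then consider "i mod 5 = 0" | "i mod 5 = 1" | "i mod 5 = 2" | "i mod 5 = 3" | "i mod 5 = 4"
        by linarith
      then show "g (melikyan_map a) i j = a i j"
        by cases (use i in \<open>simp_all add: g_def melikyan_map_def dp_scale_def dp_component_def
          dp_d2_def Let_def * distrib_left\<close>)
    qed
    show "\<forall>u\<in>mel_carrier. melikyan_map (g u) = u"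
      by (auto simp: g_def melikyan_map_def dp_scale_def dp_component_def dp_d2_def fun_eq_iff
          Let_def * distrib_left right_diff_distrib simp del: add_2_eq_Suc')
    show "melikyan_map ` dp_carrier 2 1 \<subseteq> (mel_carrier :: 'k mel set)"
      using mem by blast
    show "g ` mel_carrier \<subseteq> dp_carrier 2 1"
    proof safe
      fix f D1 D2 E1 E2 :: "'k dp"
      assume "(f, (D1, D2), (E1, E2)) \<in> mel_carrier"
      then have 0: "u i j = 0" if "u \<in> {f, D1, D2, E1, E2}" "\<not> (i < 5 \<and> j < 5)" for u i j
        using that by (auto simp: mel_carrier_def dp_carrier_def char)
      have "g (f, (D1, D2), (E1, E2)) i j = 0" if "\<not> (i < 25 \<and> j < 5)" for i j
      proof -
        have "\<not> (i div 5 < 5 \<and> j < 5)" "\<not> (i div 5 < 5 \<and> Suc j < 5)" using that by auto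
        then have "f (i div 5) j = 0" "D1 (i div 5) j = 0" "D2 (i div 5) j = 0"
          "E1 (i div 5) j = 0" "E2 (i div 5) j = 0" "D1 (i div 5) (Suc j) = 0"
          using 0 by blast+
        then show ?thesis by (simp add: g_def Let_def)
      qed
      then show "g (f, (D1, D2), (E1, E2)) \<in> dp_carrier 2 1"
        by (auto simp: dp_carrier_def char)
    qed
  qed
qed

theorem mainTheorem1:
  assumes "CHAR('k::alg_closed_field) = 5"
  shows "lie_isomorphic
           dp_scale (dp_carrier 2 1 :: 'k dp set) deformed_bracket
           mel_scale (mel_carrier :: 'k mel set) mel_bracket"
  by (rule lie_isomorphicI[OF lie_algebra_deformed[OF assms] vector_space_mel_scale
        subspace_mel_carrier bij_betw_melikyan_map[OF assms]])
    (simp_all add: melikyan_map_linear melikyan_map_bracket[OF assms])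

end
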